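(* Let $(a_n)_{n\ge0}$ and $(b_n)_{n\ge0}$ be nearly linear recurrence sequences whose characteristic polynomials are both separable and have dominating roots $\alpha$ and $\beta$ respectively, with $|\alpha|>1$, $|\beta|>1$, and $\alpha,\beta$ multiplicatively dependent. If the equation $a_k=b_m$ has infinitely many solutions in non-negative integers $k,m$, then there exist integers $u,v,w$ with $v\neq0$ such that $k=um/v+w/v$ for all but finitely many of these solutions $(k,m)$.
   Context: A sequence $(a_n)_{n\ge 0}$ of complex numbers is a nearly linear recurrence sequence if there exist an integer $d\ge 0$ and complex numbers $A_0,\dots,A_{d-1}$ such that $(a_{n+d}+A_{d-1}a_{n+d-1}+\cdots+A_0a_n)_{n\ge 0}$ is bounded. The set of polynomials $B_tx^t+\cdots+B_0\in\mathbb{C}[x]$ such that $(\sum_{i=0}^t B_ia_{n+i})_{n\ge 0}$ is bounded is an ideal of $\mathbb{C}[x]$; its unique monic generator is the characteristic polynomial. A root $\alpha$ of a polynomial $P$ is dominating if $|\alpha|>|\beta|$ for every other root $\beta$ of $P$. Nonzero $\alpha,\beta$ are multiplicatively dependent if $\alpha^m\beta^n=1$ for some integers $m,n$ not both zero. *)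

theory Defs
  imports "HOL-Analysis.Analysis" "HOL-Computational_Algebra.Computational_Algebra"
begin

definition nearly_linear_recurrence :: "(nat \<Rightarrow> complex) \<Rightarrow> bool" where
  "nearly_linear_recurrence a \<longleftrightarrow>
     (\<exists>(d::nat) (A :: nat \<Rightarrow> complex). bounded (range (\<lambda>n. a (n + d) + (\<Sum>i<d. A i * a (n + i)))))"

definition bounding_polys :: "(nat \<Rightarrow> complex) \<Rightarrow> complex poly set" where
  "bounding_polys a = {B. bounded (range (\<lambda>n. \<Sum>i\<le>degree B. coeff B i * a (n + i)))}"

text \<open>
  The monic generator of the ideal \<^term>\<open>bounding_polys a\<close>. It exists and is unique for every
  nearly linear recurrence sequence, see \<open>characteristic_polynomial_unique\<close> below; for other
  sequences the ideal is zero and the value is unspecified.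
\<close>
definition characteristic_polynomial :: "(nat \<Rightarrow> complex) \<Rightarrow> complex poly" where
  "characteristic_polynomial a = (THE P. lead_coeff P = 1 \<and> bounding_polys a = {Q. P dvd Q})"

definition dominating_root :: "complex poly \<Rightarrow> complex \<Rightarrow> bool" where
  "dominating_root P \<alpha> \<longleftrightarrow>
     poly P \<alpha> = 0 \<and> (\<forall>\<beta>. poly P \<beta> = 0 \<and> \<beta> \<noteq> \<alpha> \<longrightarrow> norm \<alpha> > norm \<beta>)"

definition multiplicatively_dependent :: "complex \<Rightarrow> complex \<Rightarrow> bool" where
  "multiplicatively_dependent \<alpha> \<beta> \<longleftrightarrow>
     \<alpha> \<noteq> 0 \<and> \<beta> \<noteq> 0 \<and>
     (\<exists>m n :: int. (m \<noteq> 0 \<or> n \<noteq> 0) \<and> \<alpha> powi m * \<beta> powi n = 1)"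

lemma bounding_polys_iff:
  assumes "degree B \<le> N"
  shows "B \<in> bounding_polys a \<longleftrightarrow> bounded (range (\<lambda>n. \<Sum>i\<le>N. coeff B i * a (n + i)))"
proof -
  have "(\<Sum>i\<le>degree B. coeff B i * a (n + i)) = (\<Sum>i\<le>N. coeff B i * a (n + i))" for n
    using assms by (intro sum.mono_neutral_left) (auto simp: coeff_eq_0)
  then show ?thesis by (simp add: bounding_polys_def)
qed

lemma bounding_polys_0: "0 \<in> bounding_polys a"
  by (simp add: bounding_polys_def)

lemma bounding_polys_add:
  assumes "P \<in> bounding_polys a" "Q \<in> bounding_polys a"
  shows "P + Q \<in> bounding_polys a"
proof -
  define N where "N = max (degree P) (degree Q)"
  have N: "degree P \<le> N" "degree Q \<le> N" "degree (P + Q) \<le> N"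
    by (auto simp: N_def degree_add_le)
  have "bounded (range (\<lambda>n. (\<Sum>i\<le>N. coeff P i * a (n + i)) + (\<Sum>i\<le>N. coeff Q i * a (n + i))))"
    using assms N by (intro bounded_plus_comp) (simp_all add: bounding_polys_iff)
  then show ?thesis
    using N by (simp add: bounding_polys_iff algebra_simps sum.distrib)
qed

lemma bounding_polys_smult:
  assumes "P \<in> bounding_polys a"
  shows "smult c P \<in> bounding_polys a"
proof -
  have "bounded ((\<lambda>z. c * z) ` range (\<lambda>n. \<Sum>i\<le>degree P. coeff P i * a (n + i)))"
    using assms by (intro bounded_linear_image) (auto simp: bounding_polys_def bounded_linear_mult_right)
  then have "bounded (range (\<lambda>n. \<Sum>i\<le>degree P. coeff (smult c P) i * a (n + i)))"
    by (simp add: image_image sum_distrib_left mult.assoc)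
  then show ?thesis
    by (subst bounding_polys_iff[of _ "degree P"]) auto
qed

lemma bounding_polys_pCons_0:
  assumes "P \<in> bounding_polys a"
  shows "pCons 0 P \<in> bounding_polys a"
proof -
  have "bounded (range (\<lambda>n. \<Sum>i\<le>degree P. coeff P i * a (Suc n + i)))"
    using assms unfolding bounding_polys_def mem_Collect_eq by (rule bounded_subset) blast
  moreover have "(\<Sum>i\<le>Suc (degree P). coeff (pCons 0 P) i * a (n + i))
      = (\<Sum>i\<le>degree P. coeff P i * a (Suc n + i))" for n
    by (subst sum.atMost_Suc_shift) simp
  ultimately show ?thesis
    by (subst bounding_polys_iff[of _ "Suc (degree P)"]) (simp_all add: degree_pCons_le)
qed

lemma bounding_polys_mult:
  assumes "P \<in> bounding_polys a"
  shows "Q * P \<in> bounding_polys a"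
proof (induction Q)
  case 0
  show ?case by (simp add: bounding_polys_0)
next
  case (pCons c Q)
  then show ?case
    by (simp add: mult_pCons_left bounding_polys_add bounding_polys_smult bounding_polys_pCons_0 assms)
qed

lemma nearly_linear_recurrence_iff:
  "nearly_linear_recurrence a \<longleftrightarrow> (\<exists>P \<in> bounding_polys a. lead_coeff P = 1)"
proof
  assume "nearly_linear_recurrence a"
  then obtain d A where
    b: "bounded (range (\<lambda>n. a (n + d) + (\<Sum>i<d. A i * a (n + i))))"
    unfolding nearly_linear_recurrence_def by blast
  define P where "P = monom 1 d + (\<Sum>i<d. monom (A i) i :: complex poly)"
  have c: "coeff P i = (if i = d then 1 else if i < d then A i else 0)" for i
    by (auto simp: P_def coeff_sum)
  have deg: "degree P = d"
    by (intro antisym degree_le le_degree) (auto simp: c)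
  have "P \<in> bounding_polys a"
    using b by (simp add: bounding_polys_def deg c lessThan_Suc_atMost[symmetric] add.commute)
  moreover have "lead_coeff P = 1" by (simp add: deg c)
  ultimately show "\<exists>P \<in> bounding_polys a. lead_coeff P = 1" by blast
next
  assume "\<exists>P \<in> bounding_polys a. lead_coeff P = 1"
  then obtain P where P: "P \<in> bounding_polys a" "lead_coeff P = 1" by blast
  then have "bounded (range (\<lambda>n. a (n + degree P) + (\<Sum>i<degree P. coeff P i * a (n + i))))"
    by (simp add: bounding_polys_def lessThan_Suc_atMost[symmetric] add.commute)
  then show "nearly_linear_recurrence a"
    unfolding nearly_linear_recurrence_def by (intro exI)
qed

lemma characteristic_polynomial_unique:
  assumes "nearly_linear_recurrence a"
  shows "\<exists>!P. lead_coeff P = 1 \<and> bounding_polys a = {Q. P dvd Q}"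
proof -
  define M where "M P \<longleftrightarrow> P \<in> bounding_polys a \<and> lead_coeff P = 1" for P
  obtain P0 where "M P0"
    using assms by (auto simp: nearly_linear_recurrence_iff M_def)
  then obtain P where P: "M P" and min: "\<And>Q. M Q \<Longrightarrow> degree P \<le> degree Q"
    using ex_has_least_nat[of M P0 degree] by blast
  have P0: "P \<noteq> 0" using P by (auto simp: M_def)
  have "P dvd Q" if Q: "Q \<in> bounding_polys a" for Q
  proof (rule ccontr)
    assume "\<not> P dvd Q"
    define R where "R = Q mod P"
    have R0: "R \<noteq> 0" using \<open>\<not> P dvd Q\<close> by (auto simp: R_def mod_eq_0_iff_dvd)
    have "R = Q + (- (Q div P)) * P"
      by (simp add: R_def minus_div_mult_eq_mod[symmetric])
    then have "R \<in> bounding_polys a"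
      using Q P bounding_polys_add bounding_polys_mult unfolding M_def by metis
    then have "M (smult (inverse (lead_coeff R)) R)"
      using R0 by (auto simp: M_def bounding_polys_smult)
    then have "degree P \<le> degree R" using min R0 by fastforce
    moreover have "degree R < degree P"
      using R0 P0 degree_mod_less[of P Q] by (auto simp: R_def)
    ultimately show False by simp
  qed
  moreover have "Q \<in> bounding_polys a" if "P dvd Q" for Q
    using that P bounding_polys_mult unfolding M_def dvd_def by (metis mult.commute)
  ultimately have eq: "bounding_polys a = {Q. P dvd Q}" by blast
  show ?thesis
  proof (intro ex1I[of _ P] conjI)
    show "lead_coeff P = 1" using P by (simp add: M_def)
    show "bounding_polys a = {Q. P dvd Q}" by (fact eq)
    fix P' assume P': "lead_coeff P' = 1 \<and> bounding_polys a = {Q. P' dvd Q}"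
    then have "P dvd P'" "P' dvd P" using eq by auto
    then obtain c where c: "P' = P * c" by (auto elim: dvdE)
    have "P' \<noteq> 0" using P' by auto
    then have "c \<noteq> 0" using c by auto
    then have "degree c = 0"
      using c P0 \<open>P' dvd P\<close> dvd_imp_degree_le[of P' P] by (simp add: degree_mult_eq)
    then obtain x where "c = [:x:]" by (auto elim: degree_eq_zeroE)
    moreover have "lead_coeff c = 1"
      using P' P c lead_coeff_mult[of P c] by (simp add: M_def)
    ultimately show "P' = P" using c by simp
  qed
qed

lemma characteristic_polynomial:
  assumes "nearly_linear_recurrence a"
  shows "lead_coeff (characteristic_polynomial a) = 1"
    and "bounding_polys a = {Q. characteristic_polynomial a dvd Q}"
  using theI'[OF characteristic_polynomial_unique[OF assms]]
  unfolding characteristic_polynomial_def by blast+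

end

(* Only absolute values matter. Since the dominating root is simple, a(n) / alpha^n tends to a
   nonzero limit c, and b(n) / beta^n to a nonzero limit d. Hence k ln|alpha| - m ln|beta| is close
   to ln|d/c| for every solution with k and m large, and only finitely many solutions have k or m
   small. Multiplicative dependence makes ln|alpha| = q t and ln|beta| = p t for nonzero integers
   p, q, so that the integer q k - p m is eventually determined. *)

theory Submission
  imports Defs
begin

section \<open>Polynomials in the shift operator\<close>

text \<open>This is P(E) x for the shift operator E, where (E x)(n) = x(n+1).\<close>

definition shift_apply :: "complex poly \<Rightarrow> (nat \<Rightarrow> complex) \<Rightarrow> nat \<Rightarrow> complex" where
  "shift_apply P x n = (\<Sum>i\<le>degree P. coeff P i * x (n + i))"

lemma shift_apply_eq:
  assumes "degree P \<le> N"
  shows "shift_apply P x n = (\<Sum>i\<le>N. coeff P i * x (n + i))"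
  unfolding shift_apply_def
  using assms by (intro sum.mono_neutral_left) (auto simp: coeff_eq_0)

lemma bounding_polys_shift_apply:
  "P \<in> bounding_polys x \<longleftrightarrow> bounded (range (shift_apply P x))"
  by (simp add: bounding_polys_def shift_apply_def[abs_def])

text \<open>Products of polynomials act as compositions of operators, so splitting off a root
  \<gamma> turns a recurrence for \<open>x\<close> into a first-order one for
  \<open>shift_apply Q x\<close>.\<close>

lemma shift_apply_linear_factor:
  "shift_apply ([:- \<gamma>, 1:] * Q) x n = shift_apply Q x (Suc n) - \<gamma> * shift_apply Q x n"
proof -
  let ?N = "degree Q"
  have "degree ([:- \<gamma>, 1:] * Q) \<le> Suc ?N"
    using degree_mult_le[of "[:- \<gamma>, 1:]" Q] by simp
  moreover have "[:- \<gamma>, 1:] * Q = pCons 0 Q + smult (- \<gamma>) Q"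
    by (simp add: mult_pCons_left add.commute)
  ultimately have "shift_apply ([:- \<gamma>, 1:] * Q) x n
      = (\<Sum>i\<le>Suc ?N. coeff (pCons 0 Q) i * x (n + i)) - \<gamma> * (\<Sum>i\<le>Suc ?N. coeff Q i * x (n + i))"
    by (subst shift_apply_eq[of _ "Suc ?N"])
      (simp_all add: algebra_simps sum.distrib sum_subtractf sum_distrib_left del: sum.atMost_Suc)
  also have "(\<Sum>i\<le>Suc ?N. coeff (pCons 0 Q) i * x (n + i)) = shift_apply Q x (Suc n)"
    by (subst sum.atMost_Suc_shift) (simp add: shift_apply_def)
  also have "(\<Sum>i\<le>Suc ?N. coeff Q i * x (n + i)) = shift_apply Q x n"
    by (rule shift_apply_eq[symmetric]) simp
  finally show ?thesis .
qed

text \<open>Geometric sequences are eigenvectors of the shift, with Q(E) acting as multiplication by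
  \<open>poly Q \<alpha>\<close>.\<close>

lemma shift_apply_diff_geometric:
  "shift_apply Q (\<lambda>n. x n - c * \<alpha> ^ n) n = shift_apply Q x n - c * poly Q \<alpha> * \<alpha> ^ n"
  by (simp add: shift_apply_def poly_altdef algebra_simps power_add sum_subtractf sum_distrib_left)

section \<open>Exponential growth bounds from the roots\<close>

text \<open>Relative to the weight \<open>\<rho> ^ n\<close> the recurrence is a contraction, so a
  forcing term of that size leaves the solution of that size.\<close>

lemma exponential_bound_first_order:
  fixes x :: "nat \<Rightarrow> complex"
  assumes \<gamma>: "norm \<gamma> < \<rho>"
    and bd: "\<And>n. norm (x (Suc n) - \<gamma> * x n) \<le> C * \<rho> ^ n"
  shows "\<exists>C'. \<forall>n. norm (x n) \<le> C' * \<rho> ^ n"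
proof -
  have \<rho>: "\<rho> > 0" using \<gamma> norm_ge_zero[of \<gamma>] by linarith
  \<comment> \<open>The first argument covers n = 0; the second gives
    \<open>C + norm \<gamma> * C' \<le> C' * \<rho>\<close>, which closes the induction.\<close>
  define C' where "C' = max (norm (x 0)) (C / (\<rho> - norm \<gamma>))"
  have C': "C \<le> C' * (\<rho> - norm \<gamma>)"
    using \<gamma> by (simp add: C'_def flip: pos_divide_le_eq)
  have "norm (x n) \<le> C' * \<rho> ^ n" for n
  proof (induction n)
    case 0
    show ?case by (simp add: C'_def)
  next
    case (Suc n)
    have "norm (x (Suc n)) \<le> norm (x (Suc n) - \<gamma> * x n) + norm (\<gamma> * x n)"
      by (metis diff_add_cancel norm_triangle_ineq)
    also have "\<dots> \<le> C * \<rho> ^ n + norm \<gamma> * (C' * \<rho> ^ n)"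
      unfolding norm_mult by (intro add_mono bd mult_left_mono Suc) auto
    also have "\<dots> = (C + norm \<gamma> * C') * \<rho> ^ n" by (simp add: algebra_simps)
    also have "\<dots> \<le> (C' * \<rho>) * \<rho> ^ n"
      using C' \<rho> by (intro mult_right_mono) (auto simp: algebra_simps)
    finally show ?case by (simp add: mult.assoc)
  qed
  then show ?thesis by blast
qed

text \<open>Induction on the degree: a linear factor is peeled off and the first-order bound passes
  from P(E) x to Q(E) x, until only a nonzero constant is left.\<close>

lemma exponential_bound_shift_apply:
  assumes "P \<noteq> 0" and "\<And>z. poly P z = 0 \<Longrightarrow> norm z < \<rho>"
    and "\<And>n. norm (shift_apply P x n) \<le> C * \<rho> ^ n"
  shows "\<exists>C'. \<forall>n. norm (x n) \<le> C' * \<rho> ^ n"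
  using assms
proof (induction "degree P" arbitrary: P C)
  case 0
  then obtain p where p: "P = [:p:]" "p \<noteq> 0"
    by (metis degree_eq_zeroE pCons_0_0)
  have "norm (x n) \<le> (C / norm p) * \<rho> ^ n" for n
    using 0(4)[of n] p by (simp add: shift_apply_def norm_mult field_simps)
  then show ?case by blast
next
  case (Suc d)
  obtain \<gamma> where "poly P \<gamma> = 0"
    using fundamental_theorem_of_algebra_alt[of P] Suc(2) by force
  then obtain Q where Q: "P = [:- \<gamma>, 1:] * Q"
    by (meson dvdE poly_eq_0_iff_dvd)
  have "Q \<noteq> 0" using Suc(3) Q by auto
  then have deg: "d = degree Q"
    using Suc(2) unfolding Q by (subst (asm) degree_mult_eq) auto
  obtain C' where "\<forall>n. norm (shift_apply Q x n) \<le> C' * \<rho> ^ n"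
    using exponential_bound_first_order[of \<gamma> \<rho> "shift_apply Q x" C] Suc(4)[of \<gamma>] Suc(5)
    unfolding Q shift_apply_linear_factor by auto
  \<comment> \<open>Roots of \<open>Q\<close> are roots of \<open>P\<close>, so they also lie below
    \<rho>.\<close>
  then show ?case
    using Suc(1)[OF deg \<open>Q \<noteq> 0\<close>] Suc(4) unfolding Q by (metis mult_zero_right poly_mult)
qed

section \<open>Asymptotics of a nearly linear recurrence sequence\<close>

text \<open>The increments of \<open>e n / \<alpha> ^ n\<close> decay like |\<alpha>|^(-n), so this
  quotient converges with an error of the same order; multiplying back by
  \<open>\<alpha> ^ n\<close> leaves a bounded error.\<close>

lemma bounded_perturbation_geometric:
  fixes e :: "nat \<Rightarrow> complex"
  assumes \<alpha>: "norm \<alpha> > 1" and "bounded (range (\<lambda>n. e (Suc n) - \<alpha> * e n))"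
  shows "\<exists>c. bounded (range (\<lambda>n. e n - c * \<alpha> ^ n))"
proof -
  obtain C where C: "\<And>n. norm (e (Suc n) - \<alpha> * e n) \<le> C"
    using assms(2) by (auto simp: bounded_iff)
  define r where "r = inverse (norm \<alpha>)"
  have r: "0 < r" "r < 1" using \<alpha> by (auto simp: r_def inverse_less_1_iff)
  have \<alpha>0: "\<alpha> \<noteq> 0" using \<alpha> by auto
  define f where "f n = e n / \<alpha> ^ n" for n
  define g where "g n = f (Suc n) - f n" for n
  have g: "norm (g n) \<le> C * r * r ^ n" for n
  proof -
    have "g n = (e (Suc n) - \<alpha> * e n) / \<alpha> ^ Suc n"
      using \<alpha>0 by (simp add: g_def f_def field_simps)
    then have "norm (g n) = norm (e (Suc n) - \<alpha> * e n) * r ^ Suc n"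
      by (simp add: norm_divide norm_power norm_mult norm_inverse r_def power_inverse divide_inverse)
    also have "\<dots> \<le> C * r ^ Suc n" using r C by (intro mult_right_mono) auto
    finally show ?thesis by (simp add: mult_ac)
  qed
  have geo: "summable (\<lambda>n. D * r ^ n)" for D :: real
    using r by (intro summable_mult summable_geometric) auto
  have sg: "summable g"
    by (rule summable_comparison_test'[OF geo[of "C * r"], of 0]) (use g in auto)
  \<comment> \<open>By telescoping, \<open>c\<close> is the limit of \<open>f\<close>, and
    \<open>c - f n\<close> is the tail of the series from n on.\<close>
  define c where "c = f 0 + suminf g"
  have "norm (e n - c * \<alpha> ^ n) \<le> (C * r) * (1 / (1 - r))" for n
  proof -
    have "(\<Sum>i<n. g i) = f n - f 0" unfolding g_def by (rule sum_lessThan_telescope)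
    then have cf: "c - f n = (\<Sum>i. g (i + n))"
      using suminf_split_initial_segment[OF sg, of n] by (simp add: c_def)
    have gi: "norm (g (i + n)) \<le> C * r * r ^ n * r ^ i" for i
      using g[of "i + n"] by (simp add: power_add mult_ac)
    have "norm (c - f n) \<le> (\<Sum>i. C * r * r ^ n * r ^ i)"
      unfolding cf by (rule norm_suminf_le[OF gi geo])
    also have "\<dots> = C * r * r ^ n * (1 / (1 - r))"
      using r by (subst suminf_mult) (auto simp: suminf_geometric summable_geometric)
    finally have b: "norm (c - f n) \<le> C * r * r ^ n * (1 / (1 - r))" .
    have "e n - c * \<alpha> ^ n = (f n - c) * \<alpha> ^ n"
      using \<alpha>0 by (simp add: f_def field_simps)
    then have "norm (e n - c * \<alpha> ^ n) = norm (c - f n) * norm \<alpha> ^ n"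
      by (simp add: norm_mult norm_power norm_minus_commute)
    also have "\<dots> \<le> (C * r * r ^ n * (1 / (1 - r))) * norm \<alpha> ^ n"
      using b by (intro mult_right_mono) auto
    also have "\<dots> = (C * r) * (1 / (1 - r)) * (r * norm \<alpha>) ^ n"
      by (simp add: power_mult_distrib)
    also have "r * norm \<alpha> = 1" using \<alpha>0 by (simp add: r_def)
    finally show ?thesis by simp
  qed
  then show ?thesis by (auto simp: bounded_iff)
qed

text \<open>With P = (X - \<alpha>) Q, the sequence Q(E) a is e \<alpha>^n up to a bounded error.
  Subtracting a suitable c \<alpha>^n from \<open>a\<close> leaves a sequence that Q(E) makes
  bounded; all roots of Q are smaller than \<alpha>, so this remainder is o(\<alpha>^n).\<close>

lemma nearly_linear_recurrence_asymptotics: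
  assumes a: "nearly_linear_recurrence a"
    and sf: "rsquarefree (characteristic_polynomial a)"
    and dom: "dominating_root (characteristic_polynomial a) \<alpha>"
    and \<alpha>: "norm \<alpha> > 1"
  shows "\<exists>c. c \<noteq> 0 \<and> (\<lambda>n. a n / \<alpha> ^ n) \<longlonglongrightarrow> c"
proof -
  define P where "P = characteristic_polynomial a"
  have P: "bounding_polys a = {Q. P dvd Q}"
    and root: "poly P \<alpha> = 0"
    and small: "\<And>z. poly P z = 0 \<Longrightarrow> z \<noteq> \<alpha> \<Longrightarrow> norm z < norm \<alpha>"
    using characteristic_polynomial(2)[OF a] dom by (auto simp: P_def dominating_root_def)
  have \<alpha>0: "\<alpha> \<noteq> 0" using \<alpha> by auto
  have P0: "P \<noteq> 0" using sf by (auto simp: rsquarefree_def P_def)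
  obtain Q where Q: "P = [:- \<alpha>, 1:] * Q"
    using root by (meson dvdE poly_eq_0_iff_dvd)
  have Q0: "Q \<noteq> 0" using P0 Q by auto
  \<comment> \<open>Separability enters here: a root of \<open>Q\<close> at \<alpha> would be a
    double root of \<open>P\<close>.\<close>
  have Q\<alpha>: "poly Q \<alpha> \<noteq> 0"
  proof
    assume "poly Q \<alpha> = 0"
    then have "order \<alpha> Q > 0" using Q0 order_root by blast
    moreover have "order \<alpha> P = order \<alpha> [:- \<alpha>, 1:] + order \<alpha> Q"
      using P0 unfolding Q by (rule order_mult)
    moreover have "order \<alpha> [:- \<alpha>, 1:] > 0" by (subst order_gt_0_iff) auto
    moreover have "order \<alpha> P \<le> 1"
      using sf by (auto simp: rsquarefree_def P_def dest: spec[of _ \<alpha>])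
    ultimately show False by linarith
  qed
  have smallQ: "norm z < norm \<alpha>" if "poly Q z = 0" for z
    using that Q\<alpha> small[of z] by (auto simp: Q)
  have "bounded (range (shift_apply P a))"
    using P by (simp flip: bounding_polys_shift_apply)
  then have "bounded (range (\<lambda>n. shift_apply Q a (Suc n) - \<alpha> * shift_apply Q a n))"
    unfolding Q shift_apply_linear_factor[abs_def] .
  then obtain e where e: "bounded (range (\<lambda>n. shift_apply Q a n - e * \<alpha> ^ n))"
    using bounded_perturbation_geometric[OF \<alpha>] by blast
  \<comment> \<open>Minimality of \<open>P\<close>: if e = 0, then \<open>Q\<close> lies in the
    ideal although its degree is too small.\<close>
  have e0: "e \<noteq> 0"
  proof
    assume "e = 0"
    then have "Q \<in> bounding_polys a" using e by (simp add: bounding_polys_shift_apply)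
    then have "P dvd Q" using P by auto
    then have "degree P \<le> degree Q" using Q0 by (rule dvd_imp_degree_le)
    then show False unfolding Q using Q0 by (subst (asm) degree_mult_eq) auto
  qed
  \<comment> \<open>Chosen so that Q(E) maps c \<alpha>^n to e \<alpha>^n, the unbounded part of
    Q(E) a.\<close>
  define c where "c = e / poly Q \<alpha>"
  define x where "x n = a n - c * \<alpha> ^ n" for n
  obtain C where C: "norm (shift_apply Q x n) \<le> C" for n
    using e Q\<alpha> unfolding x_def shift_apply_diff_geometric by (auto simp: bounded_iff c_def)
  \<comment> \<open>Inserting 1 keeps the set nonempty when \<open>Q\<close> is constant and forces
    \<rho> > 1, so that bounded sequences are O(\<rho>^n).\<close>
  define M where "M = Max (insert 1 (norm ` {z. poly Q z = 0}))"
  have fin: "finite (insert 1 (norm ` {z. poly Q z = 0}))"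
    using poly_roots_finite[OF Q0] by simp
  have "M < norm \<alpha>" unfolding M_def using fin \<alpha> smallQ by (subst Max_less_iff) auto
  then obtain \<rho> where \<rho>: "M < \<rho>" "\<rho> < norm \<alpha>" using dense by blast
  have "1 \<le> M" unfolding M_def using fin by (intro Max_ge) auto
  then have \<rho>1: "\<rho> > 1" using \<rho> by linarith
  have small\<rho>: "norm z < \<rho>" if "poly Q z = 0" for z
  proof -
    have "norm z \<le> M" unfolding M_def using fin that by (intro Max_ge) auto
    then show ?thesis using \<rho> by linarith
  qed
  have C0: "C \<ge> 0" using C[of 0] norm_ge_zero order_trans by blast
  have "norm (shift_apply Q x n) \<le> C * \<rho> ^ n" for n
    using C[of n] C0 \<rho>1 mult_left_mono[of 1 "\<rho> ^ n" C] one_le_power[of \<rho> n] by simp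
  then obtain C' where C': "\<And>n. norm (x n) \<le> C' * \<rho> ^ n"
    using exponential_bound_shift_apply[OF Q0 small\<rho>] by blast
  have "(\<lambda>n. x n / \<alpha> ^ n) \<longlonglongrightarrow> 0"
  proof (rule Lim_null_comparison)
    show "\<forall>\<^sub>F n in sequentially. norm (x n / \<alpha> ^ n) \<le> C' * (\<rho> / norm \<alpha>) ^ n"
      using C' \<alpha> by (intro always_eventually)
        (auto simp: norm_divide norm_power power_divide intro!: divide_right_mono)
    have "(\<lambda>n. (\<rho> / norm \<alpha>) ^ n) \<longlonglongrightarrow> 0"
      using \<rho> \<rho>1 by (intro LIMSEQ_power_zero) (auto simp: divide_less_eq)
    then show "(\<lambda>n. C' * (\<rho> / norm \<alpha>) ^ n) \<longlonglongrightarrow> 0" by (rule tendsto_mult_right_zero)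
  qed
  then have "(\<lambda>n. x n / \<alpha> ^ n + c) \<longlonglongrightarrow> 0 + c" by (intro tendsto_intros)
  moreover have "x n / \<alpha> ^ n + c = a n / \<alpha> ^ n" for n
    using \<alpha>0 by (simp add: x_def field_simps)
  ultimately have "(\<lambda>n. a n / \<alpha> ^ n) \<longlonglongrightarrow> c" by simp
  moreover have "c \<noteq> 0" using e0 Q\<alpha> by (simp add: c_def)
  ultimately show ?thesis by blast
qed

section \<open>Logarithms of absolute values and finite fibres\<close>

lemma ln_norm_asymptotics:
  fixes a :: "nat \<Rightarrow> complex"
  assumes lim: "(\<lambda>n. a n / \<alpha> ^ n) \<longlonglongrightarrow> c" and c: "c \<noteq> 0" and \<alpha>: "norm \<alpha> > 1"
  shows "(\<lambda>n. ln (norm (a n)) - real n * ln (norm \<alpha>)) \<longlonglongrightarrow> ln (norm c)"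
    and "filterlim (\<lambda>n. norm (a n)) at_top sequentially"
proof -
  have nl: "(\<lambda>n. norm (a n / \<alpha> ^ n)) \<longlonglongrightarrow> norm c" by (intro tendsto_norm lim)
  then have "(\<lambda>n. ln (norm (a n / \<alpha> ^ n))) \<longlonglongrightarrow> ln (norm c)"
    using c by (intro tendsto_ln) auto
  \<comment> \<open>The logarithm of the quotient is split only where \<open>a n\<close> is
    nonzero.\<close>
  moreover have "\<forall>\<^sub>F n in sequentially. a n / \<alpha> ^ n \<noteq> 0"
    using tendsto_imp_eventually_ne[OF lim c] .
  then have "\<forall>\<^sub>F n in sequentially. ln (norm (a n / \<alpha> ^ n))
      = ln (norm (a n)) - real n * ln (norm \<alpha>)"
    by eventually_elim (auto simp: norm_divide norm_power ln_div ln_realpow)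
  ultimately show "(\<lambda>n. ln (norm (a n)) - real n * ln (norm \<alpha>)) \<longlonglongrightarrow> ln (norm c)"
    by (rule Lim_transform_eventually)
  have pow: "filterlim (\<lambda>n. norm \<alpha> ^ n) at_top sequentially"
    using filterlim_at_infinity_imp_norm_at_top[OF filterlim_realpow_sequentially_gt1[OF \<alpha>]]
    by (simp add: norm_power)
  have "filterlim (\<lambda>n. norm (a n / \<alpha> ^ n) * norm \<alpha> ^ n) at_top sequentially"
    using c by (intro filterlim_tendsto_pos_mult_at_top[OF nl] pow) auto
  moreover have "norm (a n / \<alpha> ^ n) * norm \<alpha> ^ n = norm (a n)" for n
    using \<alpha> by (auto simp: norm_divide norm_power)
  ultimately show "filterlim (\<lambda>n. norm (a n)) at_top sequentially" by simp
qed

text \<open>Used to show that fixing one index of a solution leaves finitely many choices for the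
  other.\<close>

lemma finite_fibre_norm_at_top:
  fixes a :: "nat \<Rightarrow> 'a::real_normed_vector"
  assumes "filterlim (\<lambda>n. norm (a n)) at_top sequentially"
  shows "finite {n. a n = z}"
proof -
  have "\<forall>\<^sub>F n in sequentially. norm (a n) > norm z"
    using assms by (simp add: filterlim_at_top_dense)
  then have "\<forall>\<^sub>F n in sequentially. a n \<noteq> z" by eventually_elim auto
  then show ?thesis by (simp add: eventually_cofinite flip: cofinite_eq_sequentially)
qed

text \<open>The logarithm of the absolute value of the relation is a linear relation between two
  positive numbers, so neither exponent can vanish.\<close>

lemma multiplicatively_dependent_ln_norm:
  assumes "multiplicatively_dependent \<alpha> \<beta>" "norm \<alpha> > 1" "norm \<beta> > 1"
  shows "\<exists>(p::int) (q::int) t::real. p \<noteq> 0 \<and> q \<noteq> 0 \<and> t \<noteq> 0 \<and>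
    ln (norm \<alpha>) = of_int q * t \<and> ln (norm \<beta>) = of_int p * t"
proof -
  obtain m n :: int where mn: "m \<noteq> 0 \<or> n \<noteq> 0" "\<alpha> powi m * \<beta> powi n = 1"
    using assms(1) by (auto simp: multiplicatively_dependent_def)
  have pos: "ln (norm \<alpha>) > 0" "ln (norm \<beta>) > 0" by (intro ln_gt_zero assms)+
  have "ln (norm \<alpha> powi m * norm \<beta> powi n) = 0"
    using mn(2) by (metis ln_one norm_mult norm_one norm_power_int)
  moreover have "norm \<alpha> \<noteq> 0" "norm \<beta> \<noteq> 0" using assms by auto
  ultimately have eq: "of_int m * ln (norm \<alpha>) + of_int n * ln (norm \<beta>) = 0"
    using assms by (simp add: ln_mult ln_powr flip: powr_real_of_int')
  then have "m \<noteq> 0" "n \<noteq> 0" using mn(1) pos by auto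
  \<comment> \<open>The common unit, with q = n and p = -m; it has the sign of \<open>n\<close>,
    hence the later use of \<open>\<bar>t\<bar>\<close>.\<close>
  define t where "t = ln (norm \<alpha>) / of_int n"
  have "t \<noteq> 0" "ln (norm \<alpha>) = of_int n * t" "ln (norm \<beta>) = of_int (- m) * t"
    using pos \<open>n \<noteq> 0\<close> eq by (auto simp: t_def field_simps)
  then show ?thesis using \<open>m \<noteq> 0\<close> \<open>n \<noteq> 0\<close> by (metis neg_equal_0_iff_equal)
qed

section \<open>Solutions of a(k) = b(m) lie on a line\<close>

theorem theorem6:
  fixes a b :: "nat \<Rightarrow> complex" and \<alpha> \<beta> :: complex
  assumes "nearly_linear_recurrence a"
    and "nearly_linear_recurrence b"
    and "rsquarefree (characteristic_polynomial a)"
    and "rsquarefree (characteristic_polynomial b)"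
    and "dominating_root (characteristic_polynomial a) \<alpha>"
    and "dominating_root (characteristic_polynomial b) \<beta>"
    and "norm \<alpha> > 1"
    and "norm \<beta> > 1"
    and "multiplicatively_dependent \<alpha> \<beta>"
    and "infinite {(k, m). a k = b m}"
  shows "\<exists>u v w :: int. v \<noteq> 0 \<and>
    finite {(k, m). a k = b m \<and>
      real k \<noteq> real_of_int u * real m / real_of_int v + real_of_int w / real_of_int v}"
proof -
  obtain c d where c: "c \<noteq> 0" "(\<lambda>n. a n / \<alpha> ^ n) \<longlonglongrightarrow> c"
    and d: "d \<noteq> 0" "(\<lambda>n. b n / \<beta> ^ n) \<longlonglongrightarrow> d"
    using nearly_linear_recurrence_asymptotics assms(1-8) by meson
  note la = ln_norm_asymptotics[OF c(2,1) assms(7)]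
  note lb = ln_norm_asymptotics[OF d(2,1) assms(8)]
  obtain p q :: int and t :: real where pq: "p \<noteq> 0" "q \<noteq> 0" "t \<noteq> 0"
    and l\<alpha>: "ln (norm \<alpha>) = of_int q * t" and l\<beta>: "ln (norm \<beta>) = of_int p * t"
    using multiplicatively_dependent_ln_norm[OF assms(9,7,8)] by blast
  \<comment> \<open>The approximate value of q k - p m at a solution with large indices, measured in
    units of \<open>t\<close>.\<close>
  define L where "L = (ln (norm d) - ln (norm c)) / t"
  \<comment> \<open>Two errors below |t|/4 add up to less than |t|/2, that is, less than 1/2 after
    division by |t|; this singles out one integer.\<close>
  have "\<bar>t\<bar> / 4 > 0" using pq by simp
  from LIMSEQ_D[OF la(1) this] LIMSEQ_D[OF lb(1) this] obtain K1 K2 where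
    K1: "\<And>n. n \<ge> K1 \<Longrightarrow> \<bar>ln (norm (a n)) - real n * (of_int q * t) - ln (norm c)\<bar> < \<bar>t\<bar> / 4" and
    K2: "\<And>n. n \<ge> K2 \<Longrightarrow> \<bar>ln (norm (b n)) - real n * (of_int p * t) - ln (norm d)\<bar> < \<bar>t\<bar> / 4"
    unfolding l\<alpha> l\<beta> by auto
  have line: "real k = of_int p * real m / of_int q + of_int (round L) / of_int q"
    if "a k = b m" "k \<ge> K1" "m \<ge> K2" for k m
  proof -
    \<comment> \<open>An integer within distance 1/2 of \<open>L\<close>, hence equal to
      \<open>round L\<close> for every such solution.\<close>
    define w where "w = q * int k - p * int m"
    have "\<bar>real k * (of_int q * t) - real m * (of_int p * t) - (ln (norm d) - ln (norm c))\<bar> < \<bar>t\<bar> / 2"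
      using K1[OF that(2)] K2[OF that(3)] that(1) by (simp add: abs_real_def split: if_splits)
    moreover have "real k * (of_int q * t) - real m * (of_int p * t) - (ln (norm d) - ln (norm c))
        = (of_int w - L) * t"
      using pq by (simp add: L_def w_def field_simps)
    ultimately have "\<bar>L - of_int w\<bar> < 1 / 2"
      using pq by (simp add: abs_mult abs_minus_commute)
    then have "round L = w" by (rule round_unique')
    then have "of_int (round L) = real_of_int q * real k - of_int p * real m" by (simp add: w_def)
    then show ?thesis using pq by (simp add: field_simps)
  qed
  have "finite (\<Union>k<K1. (\<lambda>m. (k, m)) ` {m. b m = a k})"
    "finite (\<Union>m<K2. (\<lambda>k. (k, m)) ` {k. a k = b m})"
    using finite_fibre_norm_at_top[OF la(2)] finite_fibre_norm_at_top[OF lb(2)] by auto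
  \<comment> \<open>An exceptional solution must violate one of the thresholds \<open>K1\<close>,
    \<open>K2\<close>, so it lies in one of finitely many finite fibres.\<close>
  moreover have "{(k, m). a k = b m \<and>
      real k \<noteq> of_int p * real m / of_int q + of_int (round L) / of_int q}
    \<subseteq> (\<Union>k<K1. (\<lambda>m. (k, m)) ` {m. b m = a k}) \<union> (\<Union>m<K2. (\<lambda>k. (k, m)) ` {k. a k = b m})"
  proof safe
    fix k m
    assume eq: "a k = b m"
      and ne: "real k \<noteq> of_int p * real m / of_int q + of_int (round L) / of_int q"
      and "(k, m) \<notin> (\<Union>m<K2. (\<lambda>k. (k, m)) ` {k. a k = b m})"
    then have "m \<ge> K2" by force
    then have "k < K1" using line[OF eq] ne by force
    then show "(k, m) \<in> (\<Union>k<K1. (\<lambda>m. (k, m)) ` {m. b m = a k})" using eq by (intro UN_I[of k]) auto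
  qed
  ultimately have "finite {(k, m). a k = b m \<and>
      real k \<noteq> of_int p * real m / of_int q + of_int (round L) / of_int q}"
    by (meson finite_Un finite_subset)
  \<comment> \<open>The witnesses are u = p, v = q and w = \<open>round L\<close>.\<close>
  then show ?thesis using pq by blast
qed

end
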